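(* Let $g_X=(X,\psi_X,\varphi_X,\omega_X,\mu_X)$ and $g_Y=(Y,\psi_Y,\varphi_Y,\omega_Y,\mu_Y)$ be two elements of $\mathcal{G}$, let $p\in[1,\infty]$, $q\in[1,\infty)$, and let $(\alpha,\beta)\in[0,1]^2$ with $\alpha+\beta\le 1$. Then there exists a coupling $\mu^*\in\Pi(\mu_X,\mu_Y)$ such that $$\mathcal{E}_{\alpha,\beta,q,p}(g_X,g_Y,\mu^* )=\min_{\mu\in\Pi(\mu_X,\mu_Y)}\mathcal{E}_{\alpha,\beta,q,p}(g_X,g_Y,\mu)=\mathrm{FNGW}_{\alpha,\beta,q,p}(g_X,g_Y),$$ i.e. the infimum of $\mu\mapsto\mathcal{E}_{\alpha,\beta,q,p}(g_X,g_Y,\mu)$ over $\Pi(\mu_X,\mu_Y)$ is attained.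
   Context: $\mathcal{G}$ is the set of tuples $(X,\psi_X,\varphi_X,\omega_X,\mu_X)$ where $X$ is a Polish space, $\psi_X:X\to\Psi$ is a bounded continuous measurable map into a fixed metric space $(\Psi,d_\Psi)$, $\varphi_X:X\times X\to\mathbb{R}$ is a bounded continuous measurable function (not necessarily symmetric), $\omega_X:X\times X\to\Omega$ is a bounded continuous measurable map into a fixed metric space $(\Omega,d_\Omega)$, and $\mu_X$ is a fully supported Borel probability measure on $X$. $\Pi(\mu_X,\mu_Y)$ denotes the set of Borel probability measures on $X\times Y$ with marginals $\mu_X$ and $\mu_Y$. For $\mu\in\Pi(\mu_X,\mu_Y)$ define the cost $c((x,y),(x',y'))=(1-\alpha-\beta)\,d_\Psi(\psi_X(x),\psi_Y(y))^q+\alpha\, d_\Omega(\omega_X(x,x'),\omega_Y(y,y'))^q+\beta\,|\varphi_X(x,x')-\varphi_Y(y,y')|^q$ and $\mathcal{E}_{\alpha,\beta,q,p}(g_X,g_Y,\mu)=\left(\int_{X\times Y}\int_{X\times Y} c((x,y),(x',y'))^p\,d\mu(x,y)\,d\mu(x',y')\right)^{1/p}$ for $p<\infty$ (for $p=\infty$, the $\mu\otimes\mu$-essential supremum of $c$). The Fused Network Gromov–Wasserstein distance is $\mathrm{FNGW}_{\alpha,\beta,q,p}(g_X,g_Y)=\inf_{\mu\in\Pi(\mu_X,\mu_Y)}\mathcal{E}_{\alpha,\beta,q,p}(g_X,g_Y,\mu)$. *)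

theory Defs
  imports "HOL-Probability.Probability"
begin

text \<open>An element g = (psi, phi, omega, mu) of the class G, on a Polish space 'a.\<close>
type_synonym ('a, 'p, 'o) gobj = "('a \<Rightarrow> 'p) \<times> ('a \<Rightarrow> 'a \<Rightarrow> real) \<times> ('a \<Rightarrow> 'a \<Rightarrow> 'o) \<times> 'a measure"

definition fully_supported :: "'a::topological_space measure \<Rightarrow> bool" where
  "fully_supported \<mu> \<longleftrightarrow> (\<forall>U. open U \<and> U \<noteq> {} \<longrightarrow> emeasure \<mu> U > 0)"

definition in_G :: "('a::polish_space, 'p::metric_space, 'o::metric_space) gobj \<Rightarrow> bool" where
  "in_G g \<longleftrightarrow> (case g of (\<psi>, \<phi>, \<omega>, \<mu>) \<Rightarrow>
      continuous_on UNIV \<psi> \<and> bounded (range \<psi>) \<and> \<psi> \<in> borel_measurable borel \<and>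
      continuous_on UNIV (\<lambda>(x, x'). \<phi> x x') \<and> bounded (range (\<lambda>(x, x'). \<phi> x x')) \<and>
        (\<lambda>(x, x'). \<phi> x x') \<in> borel_measurable borel \<and>
      continuous_on UNIV (\<lambda>(x, x'). \<omega> x x') \<and> bounded (range (\<lambda>(x, x'). \<omega> x x')) \<and>
        (\<lambda>(x, x'). \<omega> x x') \<in> borel_measurable borel \<and>
      sets \<mu> = sets borel \<and> prob_space \<mu> \<and> fully_supported \<mu>)"

definition couplings :: "'a::topological_space measure \<Rightarrow> 'b::topological_space measure \<Rightarrow> ('a \<times> 'b) measure set" where
  "couplings \<mu>X \<mu>Y = {\<mu>. sets \<mu> = sets borel \<and> prob_space \<mu> \<and>
      distr \<mu> \<mu>X fst = \<mu>X \<and> distr \<mu> \<mu>Y snd = \<mu>Y}"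

definition fngw_cost :: "real \<Rightarrow> real \<Rightarrow> real \<Rightarrow> ('a, 'p::metric_space, 'o::metric_space) gobj \<Rightarrow>
    ('b, 'p, 'o) gobj \<Rightarrow> ('a \<times> 'b) \<times> ('a \<times> 'b) \<Rightarrow> real" where
  "fngw_cost \<alpha> \<beta> q gX gY = (case gX of (\<psi>X, \<phi>X, \<omega>X, _) \<Rightarrow> case gY of (\<psi>Y, \<phi>Y, \<omega>Y, _) \<Rightarrow>
     (\<lambda>((x, y), (x', y')).
        (1 - \<alpha> - \<beta>) * dist (\<psi>X x) (\<psi>Y y) powr q
        + \<alpha> * dist (\<omega>X x x') (\<omega>Y y y') powr q
        + \<beta> * \<bar>\<phi>X x x' - \<phi>Y y y'\<bar> powr q))"

definition fngw_energy :: "real \<Rightarrow> real \<Rightarrow> real \<Rightarrow> ennreal \<Rightarrow> ('a::topological_space, 'p::metric_space, 'o::metric_space) gobj \<Rightarrow>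
    ('b::topological_space, 'p, 'o) gobj \<Rightarrow> ('a \<times> 'b) measure \<Rightarrow> ereal" where
  "fngw_energy \<alpha> \<beta> q p gX gY \<mu> =
     (if p = \<infinity> then esssup (\<mu> \<Otimes>\<^sub>M \<mu>) (\<lambda>z. ereal (fngw_cost \<alpha> \<beta> q gX gY z))
      else ereal ((\<integral>z. fngw_cost \<alpha> \<beta> q gX gY z powr enn2real p \<partial>(\<mu> \<Otimes>\<^sub>M \<mu>)) powr (1 / enn2real p)))"

definition FNGW :: "real \<Rightarrow> real \<Rightarrow> real \<Rightarrow> ennreal \<Rightarrow> ('a::topological_space, 'p::metric_space, 'o::metric_space) gobj \<Rightarrow>
    ('b::topological_space, 'p, 'o) gobj \<Rightarrow> ereal" where
  "FNGW \<alpha> \<beta> q p gX gY =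
     (INF \<mu>\<in>couplings (snd (snd (snd gX))) (snd (snd (snd gY))). fngw_energy \<alpha> \<beta> q p gX gY \<mu>)"

end

theory Submission
  imports Defs
begin

text \<open>
  Couplings of two fixed measures are compact for convergence on rectangles, even though no weak topology is used.
  By Tychonoff, a minimizing sequence of couplings converges setwise on all Borel sets along some filter; the
  limit is only finitely additive. Since the marginals are fixed and inner regular, each rectangle is
  approximated from inside by products of compact sets, uniformly along the sequence. By the finite intersection
  property the limit is therefore continuous at the empty set on an algebra containing all rectangles, and
  Caratheodory's theorem extends its restriction to a coupling.

  An open set of pairs of points is a countable union of products of rectangles, so the mass that the square of a
  coupling gives to it is lower semicontinuous. The energy depends on these masses of the superlevel sets of the
  continuous cost in a monotone way, hence is lower semicontinuous as well.
\<close>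

section \<open>Compact approximation for finitely additive set functions\<close>

text \<open>The cube of functions from \<open>'s\<close> to [0,1] is compact for the product
  topology, so the image of \<open>F\<close> has a cluster point \<open>m\<close>, and refining
  \<open>F\<close> by the preimages of the neighbourhoods of \<open>m\<close> turns clustering into
  convergence. Later \<open>'s\<close> is the type of all sets of pairs of points; on such a large
  index type a filter replaces a subsequence.\<close>

lemma convergent_subfilter:
  fixes f :: "'i \<Rightarrow> 's \<Rightarrow> real"
  assumes "F \<noteq> bot" and f: "\<And>i s. f i s \<in> {0..1}"
  obtains U m where "U \<le> F" "U \<noteq> bot" "\<And>s. ((\<lambda>i. f i s) \<longlongrightarrow> m s) U"
proof -
  let ?P = "PiE UNIV (\<lambda>_::'s. {0..1::real})"
  have "compactin (product_topology (\<lambda>_::'s. euclidean :: real topology) UNIV) ?P"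
    by (subst compactin_PiE) simp
  then have "compact ?P"
    unfolding euclidean_product_topology by simp
  moreover have "filtermap f F \<noteq> bot"
    using \<open>F \<noteq> bot\<close> by (simp add: filtermap_bot_iff)
  moreover have "eventually (\<lambda>x. x \<in> ?P) (filtermap f F)"
    using f by (simp add: eventually_filtermap PiE_iff)
  ultimately obtain m where m: "inf (nhds m) (filtermap f F) \<noteq> bot"
    unfolding compact_filter by blast
  define U where "U = inf (filtercomap f (nhds m)) F"
  have "U \<noteq> bot"
  proof
    assume "U = bot"
    then obtain P Q where "eventually P (nhds m)" "eventually Q F" "\<forall>x. \<not> (P (f x) \<and> Q x)"
      unfolding U_def trivial_limit_def eventually_inf eventually_filtercomap by metis
    \<comment> \<open>Eventually along \<open>F\<close> the value \<open>f x\<close> avoids the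
      neighbourhood \<open>P\<close> of \<open>m\<close>, so the complement of \<open>P\<close> lies
      in the image filter and \<open>m\<close> is no cluster point.\<close>
    then have "\<exists>P Q. eventually P (nhds m) \<and> eventually Q (filtermap f F) \<and> (\<forall>x. P x \<and> Q x \<longrightarrow> False)"
      by (intro exI[of _ P] exI[of _ "\<lambda>y. \<not> P y"]) (auto simp: eventually_filtermap elim: eventually_mono)
    then show False
      using m unfolding trivial_limit_def eventually_inf by blast
  qed
  moreover have "U \<le> F" by (simp add: U_def)
  moreover have "((\<lambda>i. f i s) \<longlongrightarrow> m s) U" for s
  proof -
    have "(f \<longlongrightarrow> m) U"
      unfolding U_def by (rule filterlim_mono[OF filterlim_filtercomap order_refl]) simp
    then show ?thesis
      using continuous_on_tendsto_compose[OF continuous_on_product_coordinates[of s], of f m U] by simp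
  qed
  ultimately show ?thesis using that by blast
qed

definition compact_inner :: "('a::t2_space set \<Rightarrow> real) \<Rightarrow> 'a set \<Rightarrow> bool" where
  "compact_inner m E \<longleftrightarrow> E \<in> sets borel \<and> (\<forall>e>0. \<exists>K\<subseteq>E. compact K \<and> m (E - K) < e)"

text \<open>Approximability from inside by compact sets survives finite unions and intersections,
  but not complements. Demanding it of a set and of its complement yields an algebra, provided that
  the whole space is approximable.\<close>

definition compact_regular :: "('a::t2_space set \<Rightarrow> real) \<Rightarrow> 'a set set" where
  "compact_regular m = {E. compact_inner m E \<and> compact_inner m (- E)}"

section \<open>Contents on the Borel sets: compact approximation and countably additive
  extension\<close>

context
  fixes m :: "'a::t2_space set \<Rightarrow> real"
  assumes nonneg: "\<And>A. A \<in> sets borel \<Longrightarrow> 0 \<le> m A"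
    and add: "\<And>A B. A \<in> sets borel \<Longrightarrow> B \<in> sets borel \<Longrightarrow> A \<inter> B = {} \<Longrightarrow> m (A \<union> B) = m A + m B"
begin

lemma content_empty: "m {} = 0"
  using add[of "{}" "{}"] by simp

lemma content_mono: "A \<subseteq> B \<Longrightarrow> A \<in> sets borel \<Longrightarrow> B \<in> sets borel \<Longrightarrow> m A \<le> m B"
  using add[of A "B - A"] nonneg[of "B - A"] by (auto simp: Un_absorb1)

lemma content_Un_le: "A \<in> sets borel \<Longrightarrow> B \<in> sets borel \<Longrightarrow> m (A \<union> B) \<le> m A + m B"
  using add[of A "B - A"] content_mono[of "B - A" B] by auto

lemma content_UN_le:
  "(\<And>i. C i \<in> sets borel) \<Longrightarrow> m (\<Union>i\<le>(n::nat). C i) \<le> (\<Sum>i\<le>n. m (C i))"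
proof (induction n)
  case (Suc n)
  have "m (\<Union>i\<le>Suc n. C i) \<le> m (\<Union>i\<le>n. C i) + m (C (Suc n))"
    using content_Un_le[of "\<Union>i\<le>n. C i" "C (Suc n)"] Suc.prems by (simp add: atMost_Suc Un_commute)
  then show ?case using Suc by simp
qed simp

lemma compact_innerE:
  assumes "compact_inner m E" "0 < e"
  obtains K where "K \<subseteq> E" "compact K" "K \<in> sets borel" "m (E - K) < e"
  using assms borel_closed compact_imp_closed unfolding compact_inner_def by metis

lemma compact_inner_Un:
  assumes "compact_inner m A" "compact_inner m B"
  shows "compact_inner m (A \<union> B)"
  unfolding compact_inner_def
proof (intro conjI allI impI)
  have [measurable]: "A \<in> sets borel" "B \<in> sets borel"
    using assms by (auto simp: compact_inner_def)
  show "A \<union> B \<in> sets borel" by simp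
  fix e :: real assume "0 < e"
  then have e: "0 < e/2" by simp
  obtain K where K [measurable]: "K \<subseteq> A" "compact K" "K \<in> sets borel" "m (A - K) < e/2"
    using compact_innerE[OF assms(1) e] .
  obtain L where L [measurable]: "L \<subseteq> B" "compact L" "L \<in> sets borel" "m (B - L) < e/2"
    using compact_innerE[OF assms(2) e] .
  have "m (A \<union> B - (K \<union> L)) \<le> m ((A - K) \<union> (B - L))"
    by (rule content_mono) auto
  also have "\<dots> \<le> m (A - K) + m (B - L)"
    by (rule content_Un_le) auto
  also have "\<dots> < e" using K L by simp
  finally show "\<exists>K\<subseteq>A \<union> B. compact K \<and> m (A \<union> B - K) < e"
    using K L by (intro exI[of _ "K \<union> L"]) (auto intro: compact_Un)
qed

lemma compact_inner_Int:
  assumes "compact_inner m A" "compact_inner m B"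
  shows "compact_inner m (A \<inter> B)"
  unfolding compact_inner_def
proof (intro conjI allI impI)
  have [measurable]: "A \<in> sets borel" "B \<in> sets borel"
    using assms by (auto simp: compact_inner_def)
  show "A \<inter> B \<in> sets borel" by simp
  fix e :: real assume "0 < e"
  then have e: "0 < e/2" by simp
  obtain K where K [measurable]: "K \<subseteq> A" "compact K" "K \<in> sets borel" "m (A - K) < e/2"
    using compact_innerE[OF assms(1) e] .
  obtain L where L [measurable]: "L \<subseteq> B" "compact L" "L \<in> sets borel" "m (B - L) < e/2"
    using compact_innerE[OF assms(2) e] .
  \<comment> \<open>A point of the intersection that is outside \<open>K \<inter> L\<close> misses
    \<open>K\<close> or misses \<open>L\<close>, so the same two error sets as for the union cover
    the loss.\<close>
  have "m (A \<inter> B - (K \<inter> L)) \<le> m ((A - K) \<union> (B - L))"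
    by (rule content_mono) auto
  also have "\<dots> \<le> m (A - K) + m (B - L)"
    by (rule content_Un_le) auto
  also have "\<dots> < e" using K L by simp
  finally show "\<exists>K\<subseteq>A \<inter> B. compact K \<and> m (A \<inter> B - K) < e"
    using K L by (intro exI[of _ "K \<inter> L"]) (auto intro: compact_Int)
qed

lemma algebra_compact_regular:
  assumes "compact_inner m UNIV"
  shows "algebra UNIV (compact_regular m)"
  unfolding algebra_iff_Un
proof (intro conjI ballI)
  have "compact_inner m {}"
    using content_empty by (auto simp: compact_inner_def)
  with assms show "{} \<in> compact_regular m" by (simp add: compact_regular_def)
qed (auto simp: compact_regular_def Compl_eq_Diff_UNIV[symmetric] intro: compact_inner_Un compact_inner_Int)

text \<open>Replacing the sets by compact subsets that lose mass at most \<open>e / 2 ^ Suc (Suc i)\<close> reduces continuity at the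
  empty set to the finite intersection property.\<close>

lemma compact_inner_decseq_tendsto_0:
  assumes E: "\<And>i. compact_inner m (E i)" and "decseq E" and empty: "(\<Inter>i. E i) = {}"
  shows "(\<lambda>i::nat. m (E i)) \<longlonglongrightarrow> 0"
proof -
  have [measurable]: "E i \<in> sets borel" for i
    using E by (simp add: compact_inner_def)
  have dec: "i \<le> j \<Longrightarrow> E j \<subseteq> E i" for i j using \<open>decseq E\<close> by (simp add: decseq_def)
  have "\<exists>n. m (E n) < e" if "0 < e" for e
  proof (rule ccontr)
    assume "\<nexists>n. m (E n) < e"
    then have ge: "e \<le> m (E n)" for n by (simp add: not_less)
    have "\<exists>K\<subseteq>E i. compact K \<and> K \<in> sets borel \<and> m (E i - K) < e / 2 ^ Suc (Suc i)" for i
    proof -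
      have "0 < e / 2 ^ Suc (Suc i)" using \<open>0 < e\<close> by simp
      then obtain K where "K \<subseteq> E i" "compact K" "K \<in> sets borel" "m (E i - K) < e / 2 ^ Suc (Suc i)"
        using compact_innerE[OF E] by metis
      then show ?thesis by blast
    qed
    then obtain K where K: "\<And>i. K i \<subseteq> E i" "\<And>i. compact (K i)" "\<And>i. K i \<in> sets borel"
      "\<And>i. m (E i - K i) < e / 2 ^ Suc (Suc i)" by metis
    note [measurable] = K(3)
    \<comment> \<open>The sets \<open>K i\<close> need not decrease. Their finite intersections are
      nonempty because the accumulated losses cannot exhaust the mass \<open>e\<close> of
      \<open>E n\<close>.\<close>
    have ne: "(\<Inter>i\<le>n. K i) \<noteq> {}" for n
    proof
      assume *: "(\<Inter>i\<le>n. K i) = {}"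
      \<comment> \<open>Each point of \<open>E n\<close> is missing from some \<open>K i\<close>
        with \<open>i \<le> n\<close>, yet it belongs to \<open>E i\<close> since the sequence
        decreases.\<close>
      have "E n \<subseteq> (\<Union>i\<le>n. E i - K i)"
      proof
        fix x assume "x \<in> E n"
        moreover obtain i where "i \<le> n" "x \<notin> K i" using * by auto
        ultimately show "x \<in> (\<Union>i\<le>n. E i - K i)" using dec[of i n] by auto
      qed
      then have "m (E n) \<le> m (\<Union>i\<le>n. E i - K i)"
        by (intro content_mono) auto
      also have "\<dots> \<le> (\<Sum>i\<le>n. m (E i - K i))"
        by (rule content_UN_le) auto
      also have "\<dots> \<le> (\<Sum>i\<le>n. e / 2 ^ Suc (Suc i))"
        using K(4) by (intro sum_mono less_imp_le)
      also have "\<dots> = e / 2 - e / 2 ^ Suc (Suc n)"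
        by (induction n) (auto simp: field_simps)
      also have "\<dots> < e" using \<open>0 < e\<close> by (simp add: field_simps add_pos_pos)
      finally show False using ge[of n] by simp
    qed
    have "K 0 \<inter> (\<Inter>i\<in>UNIV. K i) \<noteq> {}"
    proof (rule compact_imp_fip_image)
      fix I :: "nat set" assume "finite I"
      \<comment> \<open>Inserting 0 makes the maximum meaningful for empty \<open>I\<close>; the
        initial segment up to it contains 0 and all of \<open>I\<close>.\<close>
      then have "(\<Inter>i\<le>Max (insert 0 I). K i) \<subseteq> K 0 \<inter> (\<Inter>i\<in>I. K i)"
        by fastforce
      then show "K 0 \<inter> (\<Inter>i\<in>I. K i) \<noteq> {}" using ne by blast
    qed (auto intro: K compact_imp_closed)
    moreover have "(\<Inter>i. K i) \<subseteq> (\<Inter>i. E i)" using K(1) by (intro INF_mono) auto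
    ultimately show False using empty by simp
  qed
  moreover have "m (E k) \<le> m (E n)" if "n \<le> k" for n k
    using dec[OF that] by (intro content_mono) auto
  moreover have "0 \<le> m (E k)" for k by (intro nonneg) auto
  ultimately show ?thesis
    by (intro LIMSEQ_I) (metis abs_of_nonneg diff_zero le_less_trans real_norm_def)
qed

text \<open>A finite, finitely additive set function on an algebra that is continuous at the empty
  set extends to a measure by Caratheodory. Agreement with \<open>m\<close> is asserted only on the
  algebra: on other Borel sets the extension may differ from the content.\<close>

lemma compact_regular_extension:
  assumes "compact_inner m UNIV"
  obtains \<mu> where "measure_space UNIV (sigma_sets UNIV (compact_regular m)) \<mu>"
    "\<And>E. E \<in> compact_regular m \<Longrightarrow> \<mu> E = ennreal (m E)"
proof -
  interpret algebra UNIV "compact_regular m"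
    by (rule algebra_compact_regular) fact
  have borel: "E \<in> sets borel" if "E \<in> compact_regular m" for E
    using that by (simp add: compact_regular_def compact_inner_def)
  have "\<exists>\<mu>. (\<forall>E\<in>compact_regular m. \<mu> E = ennreal (m E)) \<and>
      measure_space UNIV (sigma_sets UNIV (compact_regular m)) \<mu>"
  proof (rule caratheodory_empty_continuous)
    show "positive (compact_regular m) (\<lambda>E. ennreal (m E))"
      using content_empty by (simp add: positive_def)
    show "additive (compact_regular m) (\<lambda>E. ennreal (m E))"
      using add nonneg borel by (auto simp: additive_def ennreal_plus)
    fix A :: "nat \<Rightarrow> 'a set"
    assume "range A \<subseteq> compact_regular m" "decseq A" "(\<Inter>i. A i) = {}"
    then have "(\<lambda>i. m (A i)) \<longlonglongrightarrow> 0"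
      by (intro compact_inner_decseq_tendsto_0) (auto simp: compact_regular_def)
    from tendsto_ennrealI[OF this] show "(\<lambda>i. ennreal (m (A i))) \<longlonglongrightarrow> 0" by simp
  qed simp
  then show ?thesis using that by blast
qed

end

section \<open>Limits of couplings\<close>

text \<open>Inner regularity of finite Borel measures on Polish spaces, turned from a supremum of
  masses into a small loss, the form that a content can inherit.\<close>

lemma inner_compact_set:
  fixes M :: "'a::polish_space measure"
  assumes "sets M = sets borel" "finite_measure M" "A \<in> sets borel" "0 < e"
  obtains K where "K \<subseteq> A" "compact K" "measure M (A - K) < e"
proof -
  interpret finite_measure M by fact
  have "\<exists>K\<in>{K. K \<subseteq> A \<and> compact K}. measure M A < measure M K + e"
  \<comment> \<open>A set of mass below \<open>e\<close> is approximated by the empty set. Otherwise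
    \<open>measure M A - e\<close> is nonnegative, so its embedding into \<open>ennreal\<close> does
    not truncate it.\<close>
  proof (cases "measure M A < e")
    case True
    then show ?thesis by (intro bexI[of _ "{}"]) auto
  next
    case False
    then have "ennreal (measure M A - e) < emeasure M A"
      using \<open>0 < e\<close> by (simp add: emeasure_eq_measure ennreal_lessI)
    then have "ennreal (measure M A - e) < (SUP K\<in>{K. K \<subseteq> A \<and> compact K}. emeasure M K)"
      using inner_regular[OF assms(1) _ assms(3)] by simp
    then obtain K where "K \<subseteq> A" "compact K" "ennreal (measure M A - e) < emeasure M K"
      unfolding less_SUP_iff by blast
    then show ?thesis
      using False by (intro bexI[of _ K]) (auto simp: emeasure_eq_measure ennreal_less_iff)
  qed
  then obtain K where K: "K \<subseteq> A" "compact K" "measure M A < measure M K + e" by blast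
  moreover have "K \<in> sets M"
    using K assms(1) by (simp add: borel_compact)
  ultimately show ?thesis
    using assms(1,3) by (intro that[of K]) (auto simp: finite_measure_Diff)
qed

section \<open>Couplings described by their values on cylinders\<close>

lemma coupling_measure_fst:
  assumes "\<gamma> \<in> couplings \<mu>X \<mu>Y" "A \<in> sets \<mu>X" "sets \<mu>X = sets borel"
  shows "measure \<gamma> (A \<times> UNIV) = measure \<mu>X A"
proof -
  have \<gamma>: "sets \<gamma> = sets borel" "distr \<gamma> \<mu>X fst = \<mu>X"
    using assms by (auto simp: couplings_def)
  have "fst \<in> measurable \<gamma> \<mu>X"
    unfolding measurable_cong_sets[OF \<gamma>(1) assms(3)]
    by (intro borel_measurable_continuous_onI continuous_on_fst continuous_on_id)
  then have "measure \<mu>X A = measure \<gamma> (fst -` A \<inter> space \<gamma>)"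
    using measure_distr[of fst \<gamma> \<mu>X A] assms \<gamma> by simp
  also have "fst -` A \<inter> space \<gamma> = A \<times> UNIV"
    using sets_eq_imp_space_eq[OF \<gamma>(1)] by auto
  finally show ?thesis by simp
qed

lemma coupling_measure_snd:
  assumes "\<gamma> \<in> couplings \<mu>X \<mu>Y" "B \<in> sets \<mu>Y" "sets \<mu>Y = sets borel"
  shows "measure \<gamma> (UNIV \<times> B) = measure \<mu>Y B"
proof -
  have \<gamma>: "sets \<gamma> = sets borel" "distr \<gamma> \<mu>Y snd = \<mu>Y"
    using assms by (auto simp: couplings_def)
  have "snd \<in> measurable \<gamma> \<mu>Y"
    unfolding measurable_cong_sets[OF \<gamma>(1) assms(3)]
    by (intro borel_measurable_continuous_onI continuous_on_snd continuous_on_id)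
  then have "measure \<mu>Y B = measure \<gamma> (snd -` B \<inter> space \<gamma>)"
    using measure_distr[of snd \<gamma> \<mu>Y B] assms \<gamma> by simp
  also have "snd -` B \<inter> space \<gamma> = UNIV \<times> B"
    using sets_eq_imp_space_eq[OF \<gamma>(1)] by auto
  finally show ?thesis by simp
qed

text \<open>The marginal conditions concern cylinders only. Cylinders are rectangles, so this
  criterion applies to a limit whose values are known just on rectangles.\<close>

lemma couplingI:
  assumes "sets \<gamma> = sets borel" "prob_space \<gamma>"
    and \<mu>: "sets \<mu>X = sets borel" "finite_measure \<mu>X" "sets \<mu>Y = sets borel" "finite_measure \<mu>Y"
    and fst: "\<And>A. A \<in> sets borel \<Longrightarrow> measure \<gamma> (A \<times> UNIV) = measure \<mu>X A"
    and snd: "\<And>B. B \<in> sets borel \<Longrightarrow> measure \<gamma> (UNIV \<times> B) = measure \<mu>Y B"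
  shows "\<gamma> \<in> couplings \<mu>X \<mu>Y"
proof -
  interpret prob_space \<gamma> by fact
  interpret X: finite_measure \<mu>X by fact
  interpret Y: finite_measure \<mu>Y by fact
  have space: "space \<gamma> = UNIV"
    using sets_eq_imp_space_eq[OF assms(1)] by simp
  have "fst \<in> measurable \<gamma> \<mu>X"
    unfolding measurable_cong_sets[OF assms(1) \<mu>(1)]
    by (intro borel_measurable_continuous_onI continuous_on_fst continuous_on_id)
  have "snd \<in> measurable \<gamma> \<mu>Y"
    unfolding measurable_cong_sets[OF assms(1) \<mu>(3)]
    by (intro borel_measurable_continuous_onI continuous_on_snd continuous_on_id)
  have "distr \<gamma> \<mu>X fst = \<mu>X"
  proof (rule measure_eqI)
    fix A assume "A \<in> sets (distr \<gamma> \<mu>X fst)"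
    moreover have "fst -` A \<inter> space \<gamma> = A \<times> UNIV" using space by auto
    ultimately show "emeasure (distr \<gamma> \<mu>X fst) A = emeasure \<mu>X A"
      using fst[of A] \<mu>(1)
        by (simp only: emeasure_distr emeasure_eq_measure X.emeasure_eq_measure sets_distr \<open>fst \<in> measurable \<gamma> \<mu>X\<close>)
  qed simp
  moreover have "distr \<gamma> \<mu>Y snd = \<mu>Y"
  proof (rule measure_eqI)
    fix A assume "A \<in> sets (distr \<gamma> \<mu>Y snd)"
    moreover have "snd -` A \<inter> space \<gamma> = UNIV \<times> A" using space by auto
    ultimately show "emeasure (distr \<gamma> \<mu>Y snd) A = emeasure \<mu>Y A"
      using snd[of A] \<mu>(3)
        by (simp only: emeasure_distr emeasure_eq_measure Y.emeasure_eq_measure sets_distr \<open>snd \<in> measurable \<gamma> \<mu>Y\<close>)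
  qed simp
  ultimately show ?thesis
    using assms by (simp add: couplings_def)
qed

text \<open>The independent coupling shows that the set over which the energy is minimized is
  nonempty.\<close>

lemma pair_measure_in_couplings:
  fixes \<mu>X :: "'a::second_countable_topology measure" and \<mu>Y :: "'b::second_countable_topology measure"
  assumes "sets \<mu>X = sets borel" "prob_space \<mu>X" "sets \<mu>Y = sets borel" "prob_space \<mu>Y"
  shows "\<mu>X \<Otimes>\<^sub>M \<mu>Y \<in> couplings \<mu>X \<mu>Y"
proof -
  interpret X: prob_space \<mu>X by fact
  interpret Y: prob_space \<mu>Y by fact
  interpret XY: pair_prob_space \<mu>X \<mu>Y ..
  have space: "space \<mu>X = UNIV" "space \<mu>Y = UNIV"
    using assms(1,3) by (auto dest: sets_eq_imp_space_eq)
  show ?thesis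
  proof (rule couplingI)
    show "sets (\<mu>X \<Otimes>\<^sub>M \<mu>Y) = sets borel"
      using sets_pair_measure_cong[OF assms(1,3)] unfolding borel_prod .
    fix A :: "'a set" assume "A \<in> sets borel"
    then show "measure (\<mu>X \<Otimes>\<^sub>M \<mu>Y) (A \<times> UNIV) = measure \<mu>X A"
      using Y.prob_space assms space
      by (simp add: measure_def Y.emeasure_pair_measure_Times enn2real_mult)
  next
    fix B :: "'b set" assume "B \<in> sets borel"
    then show "measure (\<mu>X \<Otimes>\<^sub>M \<mu>Y) (UNIV \<times> B) = measure \<mu>Y B"
      using X.prob_space assms space
      by (simp add: measure_def Y.emeasure_pair_measure_Times enn2real_mult)
  qed (use assms in \<open>auto intro: XY.prob_space_axioms X.finite_measure_axioms Y.finite_measure_axioms\<close>)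
qed

text \<open>The algebra \<open>R\<close> is \<open>compact_regular m\<close> for the setwise limit
  \<open>m\<close>; the measure \<open>\<gamma>0\<close> extends \<open>m\<close> from
  \<open>R\<close>, so the convergence to \<open>m\<close> becomes convergence to
  \<open>\<gamma>0\<close> there. Closure of \<open>R\<close> under intersections is what the later
  inclusion-exclusion argument uses.\<close>

lemma couplings_convergent_subfilter:
  fixes \<mu>X :: "'a::polish_space measure" and \<mu>Y :: "'b::polish_space measure"
    and \<gamma> :: "'i \<Rightarrow> ('a \<times> 'b) measure"
  assumes X: "sets \<mu>X = sets borel" "prob_space \<mu>X" and Y: "sets \<mu>Y = sets borel" "prob_space \<mu>Y"
    and "F \<noteq> bot" and \<gamma>: "\<And>i. \<gamma> i \<in> couplings \<mu>X \<mu>Y"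
  obtains U \<gamma>0 R where "U \<le> F" "U \<noteq> bot" "\<gamma>0 \<in> couplings \<mu>X \<mu>Y"
    "algebra UNIV R" "R \<subseteq> sets borel"
    "\<forall>A\<in>sets borel. \<forall>B\<in>sets borel. A \<times> B \<in> R"
    "\<forall>E\<in>R. ((\<lambda>i. measure (\<gamma> i) E) \<longlongrightarrow> measure \<gamma>0 E) U"
proof -
  interpret X: prob_space \<mu>X by fact
  interpret Y: prob_space \<mu>Y by fact
  have prob: "prob_space (\<gamma> i)" and sets [measurable_cong]: "sets (\<gamma> i) = sets borel" for i
    using \<gamma>[of i] by (auto simp: couplings_def)
  have rect [measurable]: "A \<times> B \<in> sets borel" if "A \<in> sets borel" "B \<in> sets borel"
    for A :: "'a set" and B :: "'b set"
    using pair_measureI[OF that] unfolding borel_prod .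
  have "measure (\<gamma> i) E \<in> {0..1}" for i E
    using prob_space.prob_le_1[OF prob] by simp
  then obtain U m where "U \<le> F" "U \<noteq> bot" and m: "\<And>E. ((\<lambda>i. measure (\<gamma> i) E) \<longlongrightarrow> m E) U"
    using convergent_subfilter[OF \<open>F \<noteq> bot\<close>, of "\<lambda>i. measure (\<gamma> i)"] by metis
  have nonneg: "0 \<le> m E" for E
    by (rule tendsto_lowerbound[OF m _ \<open>U \<noteq> bot\<close>]) simp
  have add: "m (A \<union> B) = m A + m B" if "A \<in> sets borel" "B \<in> sets borel" "A \<inter> B = {}" for A B
  proof (rule tendsto_unique[OF \<open>U \<noteq> bot\<close> m])
    have "measure (\<gamma> i) (A \<union> B) = measure (\<gamma> i) A + measure (\<gamma> i) B" for i
      using finite_measure.finite_measure_Union[OF prob_space.finite_measure[OF prob]] that sets by blast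
    then show "((\<lambda>i. measure (\<gamma> i) (A \<union> B)) \<longlongrightarrow> m A + m B) U"
      using tendsto_add[OF m m] by simp
  qed
  \<comment> \<open>On cylinders the values do not depend on \<open>i\<close>, so the limit takes
    the same value.\<close>
  have m_fst: "m (A \<times> UNIV) = measure \<mu>X A" if "A \<in> sets borel" for A
    using m[of "A \<times> UNIV"] coupling_measure_fst[OF \<gamma>] that X(1) \<open>U \<noteq> bot\<close> by (simp add: tendsto_const_iff)
  have m_snd: "m (UNIV \<times> B) = measure \<mu>Y B" if "B \<in> sets borel" for B
    using m[of "UNIV \<times> B"] coupling_measure_snd[OF \<gamma>] that Y(1) \<open>U \<noteq> bot\<close> by (simp add: tendsto_const_iff)
  have inner: "compact_inner m (A \<times> B)" if AB [measurable]: "A \<in> sets borel" "B \<in> sets borel" for A B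
    unfolding compact_inner_def
  proof (intro conjI allI impI)
    fix e :: real assume "0 < e"
    then have e: "0 < e/2" by simp
    obtain K where K: "K \<subseteq> A" "compact K" "measure \<mu>X (A - K) < e/2"
      using inner_compact_set[OF X(1) X.finite_measure_axioms AB(1) e] .
    obtain L where L: "L \<subseteq> B" "compact L" "measure \<mu>Y (B - L) < e/2"
      using inner_compact_set[OF Y(1) Y.finite_measure_axioms AB(2) e] .
    have [measurable]: "K \<in> sets borel" "L \<in> sets borel"
      using K L by (auto intro: borel_compact)
    \<comment> \<open>The loss is covered by two cylinders, whose content is dictated by the fixed
      marginals.\<close>
    have "m (A \<times> B - K \<times> L) \<le> m ((A - K) \<times> UNIV \<union> UNIV \<times> (B - L))"
      by (rule content_mono[OF nonneg add]) auto
    also have "\<dots> \<le> m ((A - K) \<times> UNIV) + m (UNIV \<times> (B - L))"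
      by (rule content_Un_le[OF nonneg add]) auto
    also have "\<dots> < e" using K L by (simp add: m_fst m_snd)
    finally show "\<exists>K'\<subseteq>A \<times> B. compact K' \<and> m (A \<times> B - K') < e"
      using K L by (intro exI[of _ "K \<times> L"]) (auto intro: compact_Times)
  qed simp
  then have "compact_inner m UNIV"
    using inner[of UNIV UNIV] by simp
  have R_rect: "A \<times> B \<in> compact_regular m" if "A \<in> sets borel" "B \<in> sets borel" for A B
  proof -
    have "- (A \<times> B) = (- A) \<times> UNIV \<union> A \<times> (- B)" by auto
    moreover have "compact_inner m ((- A) \<times> UNIV \<union> A \<times> (- B))"
      using that by (intro compact_inner_Un[OF nonneg add] inner) auto
    ultimately show ?thesis
      using inner that by (simp add: compact_regular_def)
  qed
  have R_borel: "compact_regular m \<subseteq> sets borel"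
    by (auto simp: compact_regular_def compact_inner_def)
  have alg: "algebra UNIV (compact_regular m)"
    using algebra_compact_regular[OF nonneg add] \<open>compact_inner m UNIV\<close> by blast
  obtain \<mu> where \<mu>: "measure_space UNIV (sigma_sets UNIV (compact_regular m)) \<mu>"
    "\<And>E. E \<in> compact_regular m \<Longrightarrow> \<mu> E = ennreal (m E)"
    using compact_regular_extension[OF nonneg add] \<open>compact_inner m UNIV\<close> by metis
  \<comment> \<open>By second countability the Borel rectangles generate the Borel sets of the
    product, so the extension is defined on all of them.\<close>
  have "sigma_sets UNIV (compact_regular m) = sets borel"
  proof
    show "sigma_sets UNIV (compact_regular m) \<subseteq> sets borel"
      using sets.sigma_sets_subset[OF R_borel] by simp
    have "sets (borel :: ('a \<times> 'b) measure) = sigma_sets UNIV {A \<times> B |A B. A \<in> sets borel \<and> B \<in> sets borel}"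
      unfolding borel_prod[symmetric] sets_pair_measure by simp
    also have "\<dots> \<subseteq> sigma_sets UNIV (compact_regular m)"
      using R_rect by (intro sigma_sets_mono') auto
    finally show "sets borel \<subseteq> sigma_sets UNIV (compact_regular m)" .
  qed
  with \<mu>(1) have ms: "measure_space UNIV (sets borel) \<mu>" by simp
  define \<gamma>0 where "\<gamma>0 = measure_of UNIV (sets borel) \<mu>"
  have sets0: "sets \<gamma>0 = sets borel"
    using sets.sigma_sets_eq[of borel] by (simp add: \<gamma>0_def sets_measure_of)
  have em: "emeasure \<gamma>0 E = ennreal (m E)" if "E \<in> compact_regular m" for E
    using that \<mu>(2) R_borel ms unfolding \<gamma>0_def
    by (subst emeasure_measure_of_sigma) (auto simp: measure_space_def)
  then have meas: "measure \<gamma>0 E = m E" if "E \<in> compact_regular m" for E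
    using that nonneg by (simp add: measure_def)
  have "prob_space \<gamma>0"
  proof (rule prob_spaceI)
    have "m UNIV = 1"
      using m_fst[of UNIV] X.prob_space sets_eq_imp_space_eq[OF X(1)] by simp
    then show "emeasure \<gamma>0 (space \<gamma>0) = 1"
      using em[OF R_rect[of UNIV UNIV]] sets_eq_imp_space_eq[OF sets0] by simp
  qed
  with sets0 have "\<gamma>0 \<in> couplings \<mu>X \<mu>Y"
    using X Y by (intro couplingI X.finite_measure_axioms Y.finite_measure_axioms)
      (simp_all add: meas R_rect m_fst m_snd)
  then show ?thesis
    using that \<open>U \<le> F\<close> \<open>U \<noteq> bot\<close> alg R_borel R_rect meas m by metis
qed

section \<open>Lower semicontinuity\<close>

text \<open>Inclusion-exclusion expresses the product mass of a finite union of rectangles through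
  products of masses of members of \<open>R\<close>, and these converge.\<close>

lemma tendsto_pair_measure_UN_rect:
  fixes \<gamma> :: "'i \<Rightarrow> 'a measure"
  assumes "\<And>i. prob_space (\<gamma> i)" "prob_space \<gamma>0"
    and "\<And>i. sets (\<gamma> i) = M" "sets \<gamma>0 = M" "R \<subseteq> M"
    and Int: "\<And>A B. A \<in> R \<Longrightarrow> B \<in> R \<Longrightarrow> A \<inter> B \<in> R"
    and lim: "\<And>E. E \<in> R \<Longrightarrow> ((\<lambda>i. measure (\<gamma> i) E) \<longlongrightarrow> measure \<gamma>0 E) U"
    and "\<And>j. G j \<in> R" "\<And>j. H j \<in> R"
  shows "((\<lambda>i. measure (\<gamma> i \<Otimes>\<^sub>M \<gamma> i) (\<Union>j<k::nat. G j \<times> H j)) \<longlongrightarrow>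
    measure (\<gamma>0 \<Otimes>\<^sub>M \<gamma>0) (\<Union>j<k. G j \<times> H j)) U"
  using assms(8,9)
\<comment> \<open>The factors are generalized because the overlap \<open>?V\<close> of the last
  rectangle with the earlier ones is a union of \<open>k\<close> rectangles with new
  factors.\<close>
proof (induction k arbitrary: G H)
  case (Suc k)
  let ?W = "\<Union>j<k. G j \<times> H j" and ?V = "\<Union>j<k. (G j \<inter> G k) \<times> (H j \<inter> H k)"
  have split: "measure (\<nu> \<Otimes>\<^sub>M \<nu>) (\<Union>j<Suc k. G j \<times> H j) =
      measure (\<nu> \<Otimes>\<^sub>M \<nu>) ?W + measure \<nu> (G k) * measure \<nu> (H k) - measure (\<nu> \<Otimes>\<^sub>M \<nu>) ?V"
    if "prob_space \<nu>" "sets \<nu> = M" for \<nu>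
  proof -
    interpret prob_space \<nu> by fact
    interpret P: pair_prob_space \<nu> \<nu> ..
    have [measurable]: "\<And>j. G j \<in> sets \<nu>" "\<And>j. H j \<in> sets \<nu>"
      using Suc.prems that \<open>R \<subseteq> M\<close> by auto
    have "?W \<inter> G k \<times> H k = ?V" by auto
    moreover have "(\<Union>j<Suc k. G j \<times> H j) = ?W \<union> G k \<times> H k"
      by (auto simp: less_Suc_eq)
    moreover have "measure (\<nu> \<Otimes>\<^sub>M \<nu>) (G k \<times> H k) = measure \<nu> (G k) * measure \<nu> (H k)"
      by (simp add: measure_def emeasure_pair_measure_Times enn2real_mult)
    ultimately show ?thesis
      using P.P.finite_measure_Union'[of ?W "G k \<times> H k"] P.P.finite_measure_Diff'[of "G k \<times> H k" ?W]
      by (simp add: Int_commute)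
  qed
  have V: "((\<lambda>i. measure (\<gamma> i \<Otimes>\<^sub>M \<gamma> i) ?V) \<longlongrightarrow> measure (\<gamma>0 \<Otimes>\<^sub>M \<gamma>0) ?V) U"
    by (intro Suc.IH Int Suc.prems)
  show ?case
    unfolding split[OF assms(1,3)] split[OF assms(2,4)]
    by (intro tendsto_diff tendsto_add tendsto_mult Suc.IH lim Suc.prems V)
qed simp

text \<open>A countable basis of the space of pairs of points is built from products of products of
  basic open sets. The factors \<open>G j\<close> and \<open>H j\<close> are themselves rectangles,
  hence belong to the algebra on which couplings converge.\<close>

lemma open_eq_UN_open_rect:
  fixes W :: "(('a::second_countable_topology \<times> 'b::second_countable_topology) \<times> ('a \<times> 'b)) set"
  assumes "open W"
  obtains G H where "W = (\<Union>j::nat. G j \<times> H j)"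
    "\<forall>j. \<exists>A B. open A \<and> open B \<and> G j = A \<times> B" "\<forall>j. \<exists>A B. open A \<and> open B \<and> H j = A \<times> B"
proof -
  obtain BX :: "'a set set" where BX: "countable BX" "topological_basis BX"
    using ex_countable_basis by blast
  obtain BY :: "'b set set" where BY: "countable BY" "topological_basis BY"
    using ex_countable_basis by blast
  let ?Z = "(\<lambda>(a, b). a \<times> b) ` (BX \<times> BY)"
  let ?W = "(\<lambda>(a, b). a \<times> b) ` (?Z \<times> ?Z)"
  have Z: "topological_basis ?Z" by (rule topological_basis_prod) fact+
  have W: "topological_basis ?W" by (rule topological_basis_prod) fact+
  have "countable ?W" using BX BY by (intro countable_image countable_SIGMA)
  obtain B where B: "B \<subseteq> ?W" "\<Union>B = W"
    using W \<open>open W\<close> unfolding topological_basis_def by blast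
  \<comment> \<open>Adding the empty set keeps the union and makes the family nonempty, so
    \<open>from_nat_into\<close> enumerates exactly it.\<close>
  have "countable (insert {} B)"
    using B \<open>countable ?W\<close> by (meson countable_insert countable_subset)
  then have range: "range (from_nat_into (insert {} B)) = insert {} B"
    by (simp add: range_from_nat_into)
  have "\<exists>G H. from_nat_into (insert {} B) j = G \<times> H \<and> (\<exists>A B. open A \<and> open B \<and> G = A \<times> B)
      \<and> (\<exists>A B. open A \<and> open B \<and> H = A \<times> B)" (is "?P (from_nat_into (insert {} B) j)") for j
  proof -
    have "from_nat_into (insert {} B) j \<in> insert {} B"
      using range by blast
    moreover have "?P {}"
      by (intro exI[of _ "{}"]) auto
    moreover have "?P V" if V: "V \<in> B" for V
    proof -
      obtain a b c d where "V = (a \<times> b) \<times> (c \<times> d)" "a \<in> BX" "b \<in> BY" "c \<in> BX" "d \<in> BY"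
        using subsetD[OF B(1) V] by auto
      moreover from this have "open a" "open b" "open c" "open d"
        using BX(2) BY(2) topological_basis_open by blast+
      ultimately show ?thesis
        by (intro exI[of _ "a \<times> b"] exI[of _ "c \<times> d"]) blast
    qed
    ultimately show ?thesis by (metis insertE)
  qed
  then obtain G H where GH: "\<And>j. from_nat_into (insert {} B) j = G j \<times> H j"
    "\<And>j. \<exists>A B. open A \<and> open B \<and> G j = A \<times> B" "\<And>j. \<exists>A B. open A \<and> open B \<and> H j = A \<times> B"
    by metis
  have "W = (\<Union>j. G j \<times> H j)"
    using range B(2) unfolding GH(1)[symmetric] by simp
  then show ?thesis using that GH by blast
qed

section \<open>Integrals and essential suprema of continuous functions through open superlevel
  sets\<close>

lemma step_function_bounds:
  fixes h x :: real
  assumes "0 \<le> x" "0 < h"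
  shows "(\<Sum>k=1..K. h * indicator {real k * h<..} x) \<le> x"
    and "x \<le> real (Suc K) * h \<Longrightarrow> x \<le> h + (\<Sum>k=1..K. h * indicator {real k * h<..} x)"
proof -
  \<comment> \<open>The sum is \<open>h\<close> times the number of the first \<open>K\<close>
    positive multiples of \<open>h\<close> strictly below \<open>x\<close>. The cap at
    \<open>K\<close> steps carries the induction: the next level adds \<open>h\<close> only if
    \<open>x\<close> exceeds \<open>Suc K\<close> steps.\<close>
  have "(\<Sum>k=1..K. h * indicator {real k * h<..} x) \<le> min x (real K * h)"
  proof (induction K)
    case (Suc K)
    have "(\<Sum>k=1..Suc K. h * indicator {real k * h<..} x) =
        (\<Sum>k=1..K. h * indicator {real k * h<..} x) + (if real (Suc K) * h < x then h else 0)"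
      by (simp add: indicator_def)
    moreover have "real (Suc K) * h = real K * h + h" by (simp add: algebra_simps)
    ultimately show ?case using Suc.IH \<open>0 < h\<close> by (smt (verit))
  qed (use assms in simp)
  then show "(\<Sum>k=1..K. h * indicator {real k * h<..} x) \<le> x" by simp
  have "min x (real (Suc K) * h) \<le> h + (\<Sum>k=1..K. h * indicator {real k * h<..} x)"
  proof (induction K)
    case (Suc K)
    have "(\<Sum>k=1..Suc K. h * indicator {real k * h<..} x) =
        (\<Sum>k=1..K. h * indicator {real k * h<..} x) + (if real (Suc K) * h < x then h else 0)"
      by (simp add: indicator_def)
    moreover have "real (Suc (Suc K)) * h = real (Suc K) * h + h" by (simp add: algebra_simps)
    ultimately show ?case using Suc.IH \<open>0 < h\<close> by (smt (verit))
  qed simp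
  then show "x \<le> real (Suc K) * h \<Longrightarrow> x \<le> h + (\<Sum>k=1..K. h * indicator {real k * h<..} x)" by simp
qed

text \<open>A finite staircase over the open superlevel sets approximates \<open>g\<close> from
  below within \<open>h\<close>. Its integral is a nonnegative combination of finitely many masses
  of open sets, each lower semicontinuous.\<close>

lemma integral_lower_semicontinuous:
  fixes P :: "'i \<Rightarrow> 'a::topological_space measure" and g :: "'a \<Rightarrow> real"
  assumes P: "\<And>i. prob_space (P i)" "\<And>i. sets (P i) = sets borel"
    and P0: "prob_space P0" "sets P0 = sets borel"
    and lsc: "\<And>W c. open W \<Longrightarrow> c < measure P0 W \<Longrightarrow> \<forall>\<^sub>F i in U. c < measure (P i) W"
    and g: "continuous_on UNIV g" "\<And>x. 0 \<le> g x" "\<And>x. g x \<le> C"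
    and c: "c < (\<integral>x. g x \<partial>P0)"
  shows "\<forall>\<^sub>F i in U. c < (\<integral>x. g x \<partial>P i)"
proof -
  \<comment> \<open>The gap is \<open>2 * h\<close>: the staircase costs at most \<open>h\<close>
    and the masses of its levels \<open>h / 2\<close>, which still leaves a value above
    \<open>c\<close>.\<close>
  define h where "h = ((\<integral>x. g x \<partial>P0) - c) / 2"
  have "0 < h" using c by (simp add: h_def)
  obtain K0 :: nat where "C / h \<le> real K0" using real_arch_simple by blast
  \<comment> \<open>The successor makes \<open>K\<close> positive, as the tolerance
    \<open>1 / (2 * real K)\<close> requires; the staircase then reaches the bound
    \<open>C\<close>.\<close>
  define K where "K = Suc K0"
  have "C / h \<le> real (Suc K)" using \<open>C / h \<le> real K0\<close> by (simp add: K_def)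
  then have CK: "C \<le> real (Suc K) * h" using \<open>0 < h\<close> by (simp add: field_simps)
  define W where "W k = {x. real k * h < g x}" for k :: nat
  have op: "open (W k)" for k
    unfolding W_def using g(1) by (intro open_Collect_less) auto
  have [measurable]: "g \<in> borel_measurable borel" using g(1) by (rule borel_measurable_continuous_onI)
  let ?S = "\<lambda>x. \<Sum>k=1..K. h * indicator (W k) x"
  have ind: "indicator {real k * h<..} (g x) = indicator (W k) x" for k x
    by (auto simp: W_def indicator_def)
  note S_le = step_function_bounds(1)[OF g(2) \<open>0 < h\<close>, where K=K, unfolded ind]
    and le_S = step_function_bounds(2)[OF g(2) \<open>0 < h\<close> order_trans[OF g(3) CK], unfolded ind]
  have *: "integrable Q g \<and> integrable Q ?S \<and> (\<integral>x. ?S x \<partial>Q) = (\<Sum>k=1..K. h * measure Q (W k))"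
    if "prob_space Q" "sets Q = sets borel" for Q
  proof -
    interpret prob_space Q by fact
    note [measurable_cong] = \<open>sets Q = sets borel\<close>
    have W: "W k \<in> sets Q" for k using op that by simp
    have i: "integrable Q (\<lambda>x. h * indicator (W k) x)" for k
      using W by (intro integrable_mult_right) (simp add: emeasure_eq_measure)
    have "integrable Q g"
      by (rule integrable_const_bound[where B=C]) (use g in auto)
    moreover have "(\<integral>x. ?S x \<partial>Q) = (\<Sum>k=1..K. h * measure Q (W k))"
      using W sets_eq_imp_space_eq[OF that(2)] by (subst Bochner_Integration.integral_sum[OF i]) simp
    moreover have "integrable Q ?S" using i by (rule Bochner_Integration.integrable_sum)
    ultimately show ?thesis by blast
  qed
  interpret P0: prob_space P0 by fact
  have "(\<integral>x. g x \<partial>P0) \<le> (\<integral>x. h + ?S x \<partial>P0)"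
    using *[OF P0] le_S by (intro integral_mono) auto
  also have "\<dots> = h + (\<Sum>k=1..K. h * measure P0 (W k))"
    using *[OF P0] by (simp add: P0.prob_space)
  finally have less: "c + h \<le> (\<Sum>k=1..K. h * measure P0 (W k))"
    by (simp add: h_def field_simps)
  \<comment> \<open>Each of the \<open>K\<close> levels has height \<open>h\<close>, so this
    tolerance adds up to a total loss of \<open>h / 2\<close>.\<close>
  have "\<forall>\<^sub>F i in U. \<forall>k\<in>{1..K}. measure P0 (W k) - 1 / (2 * real K) < measure (P i) (W k)"
    by (intro eventually_ball_finite ballI lsc op) (auto simp: K_def)
  then show ?thesis
  proof eventually_elim
    case (elim i)
    have "c < c + h - h / 2" using \<open>0 < h\<close> by simp
    also have "\<dots> \<le> (\<Sum>k=1..K. h * measure P0 (W k)) - (\<Sum>k=1..K. h * (1 / (2 * real K)))"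
    proof -
      have "(\<Sum>k=1..K. h * (1 / (2 * real K))) = h / 2"
        by (simp only: sum_constant) (simp add: K_def field_simps)
      then show ?thesis using less by linarith
    qed
    also have "\<dots> = (\<Sum>k=1..K. h * (measure P0 (W k) - 1 / (2 * real K)))"
      by (simp add: sum_subtractf right_diff_distrib)
    also have "\<dots> \<le> (\<Sum>k=1..K. h * measure (P i) (W k))"
      using elim \<open>0 < h\<close> by (intro sum_mono mult_left_mono less_imp_le) auto
    also have "\<dots> = (\<integral>x. ?S x \<partial>P i)" using *[OF P] by simp
    also have "\<dots> \<le> (\<integral>x. g x \<partial>P i)"
      using *[OF P] S_le by (intro integral_mono) auto
    finally show ?case .
  qed
qed

text \<open>If \<open>c\<close> lies below the essential supremum, the open set where
  \<open>g\<close> exceeds \<open>c\<close> has positive mass. Positivity persists along the filter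
  and keeps the essential supremum from falling below \<open>c\<close>.\<close>

lemma esssup_lower_semicontinuous:
  fixes P :: "'i \<Rightarrow> 'a::topological_space measure" and g :: "'a \<Rightarrow> ereal"
  assumes P: "\<And>i. prob_space (P i)" "\<And>i. sets (P i) = sets borel"
    and P0: "prob_space P0" "sets P0 = sets borel"
    and lsc: "\<And>W c. open W \<Longrightarrow> c < measure P0 W \<Longrightarrow> \<forall>\<^sub>F i in U. c < measure (P i) W"
    and g: "continuous_on UNIV g"
    and c: "c < esssup P0 g"
  shows "\<forall>\<^sub>F i in U. c \<le> esssup (P i) g"
proof -
  have gm: "g \<in> borel_measurable borel"
    using g by (rule borel_measurable_continuous_onI)
  have space: "space Q = UNIV" "g \<in> borel_measurable Q" if "sets Q = sets borel" for Q :: "'a measure"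
    using sets_eq_imp_space_eq[OF that] gm measurable_cong_sets[OF that refl] by auto
  have op: "open {x. c < g x}"
    using g by (intro open_Collect_less) auto
  interpret P0: prob_space P0 by fact
  have "0 < measure P0 {x. c < g x}"
    using esssup_pos_measure[OF space(2)[OF P0(2)] c] space(1)[OF P0(2)]
    by (simp add: P0.emeasure_eq_measure)
  from lsc[OF op this] show ?thesis
  proof eventually_elim
    case (elim i)
    interpret prob_space "P i" by (rule P)
    show ?case
    proof (rule ccontr)
      assume "\<not> c \<le> esssup (P i) g"
      then have "AE x in P i. \<not> c < g x"
        using esssup_AE[of g "P i"] by (auto elim!: eventually_mono)
      then have "measure (P i) {x. c < g x} = 0"
        using op P(2)[of i] by (simp add: AE_iff_measurable[of "{x. c < g x}"] space measure_def)
      with elim show False by simp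
    qed
  qed
qed

section \<open>The energy\<close>

text \<open>Countable unions of rectangles only give a lower bound: finite unions have convergent
  mass, while the remaining mass of \<open>W\<close> is bounded below by 0.\<close>

lemma couplings_pair_lower_semicontinuous:
  fixes \<mu>X :: "'a::polish_space measure" and \<mu>Y :: "'b::polish_space measure"
    and \<gamma> :: "'i \<Rightarrow> ('a \<times> 'b) measure"
  assumes X: "sets \<mu>X = sets borel" "prob_space \<mu>X" and Y: "sets \<mu>Y = sets borel" "prob_space \<mu>Y"
    and "F \<noteq> bot" and \<gamma>: "\<And>i. \<gamma> i \<in> couplings \<mu>X \<mu>Y"
  obtains U \<gamma>0 where "U \<le> F" "U \<noteq> bot" "\<gamma>0 \<in> couplings \<mu>X \<mu>Y"
    "\<forall>W c. open W \<longrightarrow> c < measure (\<gamma>0 \<Otimes>\<^sub>M \<gamma>0) W \<longrightarrow> (\<forall>\<^sub>F i in U. c < measure (\<gamma> i \<Otimes>\<^sub>M \<gamma> i) W)"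
proof -
  obtain U \<gamma>0 R where U: "U \<le> F" "U \<noteq> bot" and \<gamma>0: "\<gamma>0 \<in> couplings \<mu>X \<mu>Y"
    and R: "algebra UNIV R" "R \<subseteq> sets borel"
      "\<forall>A\<in>sets borel. \<forall>B\<in>sets borel. A \<times> B \<in> R"
    and lim: "\<forall>E\<in>R. ((\<lambda>i. measure (\<gamma> i) E) \<longlongrightarrow> measure \<gamma>0 E) U"
    by (rule couplings_convergent_subfilter[where \<gamma>=\<gamma>, OF X Y \<open>F \<noteq> bot\<close> \<gamma>])
  have coupling: "prob_space \<nu>" "sets \<nu> = sets borel" if "\<nu> \<in> couplings \<mu>X \<mu>Y" for \<nu>
    using that by (auto simp: couplings_def)
  have lsc: "\<forall>\<^sub>F i in U. c < measure (\<gamma> i \<Otimes>\<^sub>M \<gamma> i) W" if "open W" "c < measure (\<gamma>0 \<Otimes>\<^sub>M \<gamma>0) W" for W c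
  proof -
    obtain G H where W: "W = (\<Union>j::nat. G j \<times> H j)"
      and G: "\<forall>j. \<exists>A B. open A \<and> open B \<and> G j = A \<times> B"
      and H: "\<forall>j. \<exists>A B. open A \<and> open B \<and> H j = A \<times> B"
      by (rule open_eq_UN_open_rect[OF \<open>open W\<close>])
    have GR: "G j \<in> R" for j using G R(3) borel_open by metis
    have HR: "H j \<in> R" for j using H R(3) borel_open by metis
    let ?V = "\<lambda>k. \<Union>j<k. G j \<times> H j"
    have sets: "G j \<times> H j \<in> sets (\<nu> \<Otimes>\<^sub>M \<nu>)" if "\<nu> \<in> couplings \<mu>X \<mu>Y" for \<nu> j
      using coupling(2)[OF that] GR HR R(2) by (intro pair_measureI) auto
    interpret \<gamma>0: prob_space \<gamma>0 by (rule coupling) fact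
    interpret \<gamma>0: pair_prob_space \<gamma>0 \<gamma>0 ..
    \<comment> \<open>The number \<open>k\<close> of rectangles is chosen first, for the limit
      coupling alone; only then does \<open>i\<close> run along the filter.\<close>
    have "(\<lambda>k. measure (\<gamma>0 \<Otimes>\<^sub>M \<gamma>0) (?V k)) \<longlonglongrightarrow> measure (\<gamma>0 \<Otimes>\<^sub>M \<gamma>0) (\<Union>k. ?V k)"
      using sets[OF \<gamma>0] by (intro \<gamma>0.P.finite_Lim_measure_incseq) (blast, intro monoI UN_mono, auto)
    moreover have "(\<Union>k. ?V k) = W" unfolding W by auto
    ultimately have "\<forall>\<^sub>F k in sequentially. c < measure (\<gamma>0 \<Otimes>\<^sub>M \<gamma>0) (?V k)"
      using that(2) by (auto dest: order_tendstoD)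
    then obtain k where "c < measure (\<gamma>0 \<Otimes>\<^sub>M \<gamma>0) (?V k)"
      by (auto simp: eventually_sequentially)
    moreover have "((\<lambda>i. measure (\<gamma> i \<Otimes>\<^sub>M \<gamma> i) (?V k)) \<longlongrightarrow> measure (\<gamma>0 \<Otimes>\<^sub>M \<gamma>0) (?V k)) U"
    proof (rule tendsto_pair_measure_UN_rect[where M="sets borel" and R=R])
      show "A \<inter> B \<in> R" if "A \<in> R" "B \<in> R" for A B
        using R(1) that by (simp add: algebra_iff_Int)
    qed (use coupling \<gamma> \<gamma>0 R lim GR HR in blast)+
    ultimately have "\<forall>\<^sub>F i in U. c < measure (\<gamma> i \<Otimes>\<^sub>M \<gamma> i) (?V k)"
      by (auto dest: order_tendstoD)
    then show ?thesis
    proof eventually_elim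
      case (elim i)
      interpret prob_space "\<gamma> i" by (rule coupling) fact
      interpret pair_prob_space "\<gamma> i" "\<gamma> i" ..
      have "measure (\<gamma> i \<Otimes>\<^sub>M \<gamma> i) (?V k) \<le> measure (\<gamma> i \<Otimes>\<^sub>M \<gamma> i) W"
        using sets[OF \<gamma>[of i]] unfolding W by (intro P.finite_measure_mono) auto
      with elim show ?case by simp
    qed
  qed
  from U \<gamma>0 show ?thesis by (rule that) (intro allI impI lsc)
qed

section \<open>Regularity of the cost and lower semicontinuity of the energy\<close>

lemma dist_powr_bounded:
  fixes f :: "'a \<Rightarrow> 'm::metric_space" and g :: "'b \<Rightarrow> 'm"
  assumes "bounded (range f)" "bounded (range g)" "0 \<le> q"
  shows "\<exists>C. \<forall>x y. dist (f x) (g y) powr q \<le> C"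
proof -
  have "dist (f x) (g y) \<le> diameter (range f \<union> range g)" for x y
    using assms by (intro diameter_bounded_bound) auto
  then show ?thesis
    using \<open>0 \<le> q\<close> by (intro exI[of _ "diameter (range f \<union> range g) powr q"] allI powr_mono2) auto
qed

context
  fixes gX :: "('a::polish_space, 'p::metric_space, 'o::metric_space) gobj"
    and gY :: "('b::polish_space, 'p, 'o) gobj"
    and \<alpha> \<beta> q :: real
  assumes g: "in_G gX" "in_G gY"
    and q: "1 \<le> q" and \<alpha>\<beta>: "0 \<le> \<alpha>" "0 \<le> \<beta>" "\<alpha> + \<beta> \<le> 1"
begin

lemma fngw_cost_nonneg: "0 \<le> fngw_cost \<alpha> \<beta> q gX gY z"
  using \<alpha>\<beta> by (auto simp: fngw_cost_def split: prod.split intro!: add_nonneg_nonneg mult_nonneg_nonneg)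

lemma fngw_cost_continuous: "continuous_on UNIV (fngw_cost \<alpha> \<beta> q gX gY)"
proof -
  obtain \<psi>X \<phi>X \<omega>X \<mu>X where gX: "gX = (\<psi>X, \<phi>X, \<omega>X, \<mu>X)" by (cases gX)
  obtain \<psi>Y \<phi>Y \<omega>Y \<mu>Y where gY: "gY = (\<psi>Y, \<phi>Y, \<omega>Y, \<mu>Y)" by (cases gY)
  have cont: "continuous_on UNIV \<psi>X" "continuous_on UNIV (\<lambda>(x, x'). \<phi>X x x')" "continuous_on UNIV (\<lambda>(x, x'). \<omega>X x x')"
    "continuous_on UNIV \<psi>Y" "continuous_on UNIV (\<lambda>(x, x'). \<phi>Y x x')" "continuous_on UNIV (\<lambda>(x, x'). \<omega>Y x x')"
    using g by (auto simp: gX gY in_G_def)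
  have z:
    "continuous_on UNIV (\<lambda>z :: ('a \<times> 'b) \<times> ('a \<times> 'b). \<psi>X (fst (fst z)))"
    "continuous_on UNIV (\<lambda>z :: ('a \<times> 'b) \<times> ('a \<times> 'b). \<psi>Y (snd (fst z)))"
    "continuous_on UNIV (\<lambda>z :: ('a \<times> 'b) \<times> ('a \<times> 'b). \<phi>X (fst (fst z)) (fst (snd z)))"
    "continuous_on UNIV (\<lambda>z :: ('a \<times> 'b) \<times> ('a \<times> 'b). \<phi>Y (snd (fst z)) (snd (snd z)))"
    "continuous_on UNIV (\<lambda>z :: ('a \<times> 'b) \<times> ('a \<times> 'b). \<omega>X (fst (fst z)) (fst (snd z)))"
    "continuous_on UNIV (\<lambda>z :: ('a \<times> 'b) \<times> ('a \<times> 'b). \<omega>Y (snd (fst z)) (snd (snd z)))"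
    using continuous_on_compose2[OF cont(1), of UNIV "\<lambda>z :: ('a \<times> 'b) \<times> ('a \<times> 'b). fst (fst z)"]
      continuous_on_compose2[OF cont(4), of UNIV "\<lambda>z :: ('a \<times> 'b) \<times> ('a \<times> 'b). snd (fst z)"]
      continuous_on_compose2[OF cont(2), of UNIV "\<lambda>z :: ('a \<times> 'b) \<times> ('a \<times> 'b). (fst (fst z), fst (snd z))"]
      continuous_on_compose2[OF cont(5), of UNIV "\<lambda>z :: ('a \<times> 'b) \<times> ('a \<times> 'b). (snd (fst z), snd (snd z))"]
      continuous_on_compose2[OF cont(3), of UNIV "\<lambda>z :: ('a \<times> 'b) \<times> ('a \<times> 'b). (fst (fst z), fst (snd z))"]
      continuous_on_compose2[OF cont(6), of UNIV "\<lambda>z :: ('a \<times> 'b) \<times> ('a \<times> 'b). (snd (fst z), snd (snd z))"]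
    by (simp_all add: continuous_on_fst continuous_on_snd continuous_on_Pair)
  show ?thesis
    \<comment> \<open>The exponent is positive, so \<open>powr\<close> is continuous also where a
      distance vanishes.\<close>
    using q unfolding gX gY fngw_cost_def case_prod_beta fst_conv snd_conv
    by (intro continuous_on_add continuous_on_mult continuous_on_const continuous_on_powr' continuous_on_dist
        continuous_on_rabs continuous_on_diff z) auto
qed

lemma fngw_cost_bounded: "\<exists>C. \<forall>z. fngw_cost \<alpha> \<beta> q gX gY z \<le> C"
proof -
  obtain \<psi>X \<phi>X \<omega>X \<mu>X where gX: "gX = (\<psi>X, \<phi>X, \<omega>X, \<mu>X)" by (cases gX)
  obtain \<psi>Y \<phi>Y \<omega>Y \<mu>Y where gY: "gY = (\<psi>Y, \<phi>Y, \<omega>Y, \<mu>Y)" by (cases gY)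
  obtain C1 where C1: "\<And>x y. dist (\<psi>X x) (\<psi>Y y) powr q \<le> C1"
    using dist_powr_bounded[of \<psi>X \<psi>Y q] g q by (auto simp: gX gY in_G_def)
  obtain C2 where C2: "\<And>x x' y y'. dist (\<omega>X x x') (\<omega>Y y y') powr q \<le> C2"
    using dist_powr_bounded[of "\<lambda>(x, x'). \<omega>X x x'" "\<lambda>(y, y'). \<omega>Y y y'" q] g q by (auto simp: gX gY in_G_def)
  \<comment> \<open>The absolute difference is treated as a distance of reals, so one bound serves
    all three terms.\<close>
  obtain C3 where C3: "\<And>x x' y y'. dist (\<phi>X x x') (\<phi>Y y y') powr q \<le> C3"
    using dist_powr_bounded[of "\<lambda>(x, x'). \<phi>X x x'" "\<lambda>(y, y'). \<phi>Y y y'" q] g q by (auto simp: gX gY in_G_def)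
  have "fngw_cost \<alpha> \<beta> q gX gY z \<le> (1 - \<alpha> - \<beta>) * C1 + \<alpha> * C2 + \<beta> * C3" for z
    using \<alpha>\<beta> C1 C2 C3 unfolding gX gY fngw_cost_def dist_real_def
    by (auto split: prod.split intro!: add_mono mult_left_mono)
  then show ?thesis by blast
qed

text \<open>For infinite \<open>p\<close> the claim is that on essential suprema. For finite
  \<open>p\<close> it is that on integrals of a bounded continuous power of the cost, carried
  through the increasing root.\<close>

lemma fngw_energy_lower_semicontinuous:
  assumes P: "\<And>i. prob_space (\<gamma> i)" "\<And>i. sets (\<gamma> i) = sets borel"
    and P0: "prob_space \<gamma>0" "sets \<gamma>0 = sets borel"
    and lsc: "\<And>W c. open W \<Longrightarrow> c < measure (\<gamma>0 \<Otimes>\<^sub>M \<gamma>0) W \<Longrightarrow> \<forall>\<^sub>F i in U. c < measure (\<gamma> i \<Otimes>\<^sub>M \<gamma> i) W"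
    and "1 \<le> p" and t: "t < fngw_energy \<alpha> \<beta> q p gX gY \<gamma>0"
  shows "\<forall>\<^sub>F i in U. t \<le> fngw_energy \<alpha> \<beta> q p gX gY (\<gamma> i)"
proof -
  let ?c = "fngw_cost \<alpha> \<beta> q gX gY"
  have pair: "prob_space (\<nu> \<Otimes>\<^sub>M \<nu>)" "sets (\<nu> \<Otimes>\<^sub>M \<nu>) = sets borel"
    if "prob_space \<nu>" "sets \<nu> = sets borel" for \<nu> :: "('a \<times> 'b) measure"
  proof -
    interpret prob_space \<nu> by fact
    interpret pair_prob_space \<nu> \<nu> ..
    show "prob_space (\<nu> \<Otimes>\<^sub>M \<nu>)" by (rule P.prob_space_axioms)
    show "sets (\<nu> \<Otimes>\<^sub>M \<nu>) = sets borel"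
      using sets_pair_measure_cong[OF that(2) that(2)] unfolding borel_prod .
  qed
  note PP = pair[OF P(1) P(2)] pair[OF P0]
  show ?thesis
  proof (cases "p = \<infinity>")
    case True
    have "continuous_on UNIV (\<lambda>z. ereal (?c z))"
      using fngw_cost_continuous by (intro continuous_intros)
    from esssup_lower_semicontinuous[OF PP lsc this] show ?thesis
      using t True by (simp add: fngw_energy_def)
  next
    case False
    define r where "r = enn2real p"
    have "1 \<le> r"
      using \<open>1 \<le> p\<close> False enn2real_mono[of 1 p] by (simp add: r_def top.not_eq_extremum)
    have E: "fngw_energy \<alpha> \<beta> q p gX gY \<nu> = ereal ((\<integral>z. ?c z powr r \<partial>(\<nu> \<Otimes>\<^sub>M \<nu>)) powr (1 / r))" for \<nu>
      using False by (simp add: fngw_energy_def r_def)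
    show ?thesis
    \<comment> \<open>Energies are nonnegative, which settles \<open>t \<le> 0\<close>. A positive
      \<open>t\<close> below the finite energy is a real number, and raising it to the power
      \<open>r\<close> is strictly monotone.\<close>
    proof (cases "t \<le> 0")
      case True
      then show ?thesis
        unfolding E by (intro always_eventually allI order_trans[OF True]) simp
    next
      case False
      with t obtain s where s: "t = ereal s" "0 < s" unfolding E by (cases t) auto
      have I: "0 \<le> (\<integral>z. ?c z powr r \<partial>(\<nu> \<Otimes>\<^sub>M \<nu>))" for \<nu> by simp
      have inv: "(x powr r) powr (1 / r) = x" "(x powr (1 / r)) powr r = x" if "0 \<le> x" for x :: real
        using that \<open>1 \<le> r\<close> by (simp_all add: powr_powr)
      have "s < (\<integral>z. ?c z powr r \<partial>(\<gamma>0 \<Otimes>\<^sub>M \<gamma>0)) powr (1 / r)"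
        using t unfolding E s by simp
      then have "s powr r < (\<integral>z. ?c z powr r \<partial>(\<gamma>0 \<Otimes>\<^sub>M \<gamma>0))"
        using powr_less_mono2[of r s] inv(2)[OF I] s(2) \<open>1 \<le> r\<close> by fastforce
      moreover obtain C where "\<And>z. ?c z \<le> C" using fngw_cost_bounded by blast
      moreover have "continuous_on UNIV (\<lambda>z. ?c z powr r)"
        using fngw_cost_continuous fngw_cost_nonneg \<open>1 \<le> r\<close>
        by (intro continuous_on_powr' continuous_on_const) auto
      ultimately have "\<forall>\<^sub>F i in U. s powr r < (\<integral>z. ?c z powr r \<partial>(\<gamma> i \<Otimes>\<^sub>M \<gamma> i))"
        using fngw_cost_nonneg \<open>1 \<le> r\<close>
        by (intro integral_lower_semicontinuous[OF PP lsc, where C="C powr r"]) (auto intro: powr_mono2)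
      then show ?thesis
      proof eventually_elim
        case (elim i)
        then have "(s powr r) powr (1 / r) \<le> (\<integral>z. ?c z powr r \<partial>(\<gamma> i \<Otimes>\<^sub>M \<gamma> i)) powr (1 / r)"
          using \<open>1 \<le> r\<close> by (intro powr_mono2) auto
        then show ?case
          using inv(1)[of s] s by (simp add: E)
      qed
    qed
  qed
qed

end

section \<open>Existence of an optimal coupling by the direct method\<close>

theorem theorem2p4:
  fixes gX :: "('a::polish_space, 'p::metric_space, 'o::metric_space) gobj"
    and gY :: "('b::polish_space, 'p, 'o) gobj"
    and \<alpha> \<beta> q :: real and p :: ennreal
  assumes "in_G gX" and "in_G gY"
    and "1 \<le> p" and "1 \<le> q"
    and "0 \<le> \<alpha>" and "\<alpha> \<le> 1" and "0 \<le> \<beta>" and "\<beta> \<le> 1" and "\<alpha> + \<beta> \<le> 1"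
  shows "\<exists>\<mu>s\<in>couplings (snd (snd (snd gX))) (snd (snd (snd gY))).
           (\<forall>\<mu>\<in>couplings (snd (snd (snd gX))) (snd (snd (snd gY))).
              fngw_energy \<alpha> \<beta> q p gX gY \<mu>s \<le> fngw_energy \<alpha> \<beta> q p gX gY \<mu>)
           \<and> fngw_energy \<alpha> \<beta> q p gX gY \<mu>s = FNGW \<alpha> \<beta> q p gX gY"
proof -
  let ?\<mu>X = "snd (snd (snd gX))" and ?\<mu>Y = "snd (snd (snd gY))"
  let ?C = "couplings ?\<mu>X ?\<mu>Y" and ?E = "fngw_energy \<alpha> \<beta> q p gX gY"
  have X: "sets ?\<mu>X = sets borel" "prob_space ?\<mu>X" and Y: "sets ?\<mu>Y = sets borel" "prob_space ?\<mu>Y"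
    using assms(1,2) by (auto simp: in_G_def)
  have "?E ` ?C \<noteq> {}" using pair_measure_in_couplings[OF X Y] by blast
  from Inf_as_limit[OF this] obtain u where u: "\<And>n. u n \<in> ?E ` ?C" "u \<longlonglongrightarrow> FNGW \<alpha> \<beta> q p gX gY"
    unfolding FNGW_def by blast
  have "\<exists>\<gamma>. \<forall>n. \<gamma> n \<in> ?C \<and> u n = ?E (\<gamma> n)"
    using u(1) by (intro choice) blast
  then obtain \<gamma> where \<gamma>: "\<And>n. \<gamma> n \<in> ?C" "\<And>n. u n = ?E (\<gamma> n)"
    by blast
  obtain U \<gamma>0 where U: "U \<le> sequentially" "U \<noteq> bot" and \<gamma>0: "\<gamma>0 \<in> ?C"
    and lsc: "\<forall>W c. open W \<longrightarrow> c < measure (\<gamma>0 \<Otimes>\<^sub>M \<gamma>0) W \<longrightarrow> (\<forall>\<^sub>F n in U. c < measure (\<gamma> n \<Otimes>\<^sub>M \<gamma> n) W)"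
    by (rule couplings_pair_lower_semicontinuous[where \<gamma>=\<gamma>, OF X Y sequentially_bot \<gamma>(1)])
  \<comment> \<open>The minimizing sequence keeps its limit along the finer filter
    \<open>U\<close>.\<close>
  have lim: "((\<lambda>n. ?E (\<gamma> n)) \<longlongrightarrow> FNGW \<alpha> \<beta> q p gX gY) U"
    using tendsto_mono[OF U(1) u(2)] by (simp flip: \<gamma>(2))
  have "?E \<gamma>0 \<le> FNGW \<alpha> \<beta> q p gX gY"
  \<comment> \<open>The order on \<open>ereal\<close> is dense, so it suffices to bound every
    \<open>t\<close> strictly below the energy of \<open>\<gamma>0\<close>; such \<open>t\<close>
    eventually bounds the energies of the minimizing sequence from below.\<close>
  proof (rule dense_le)
    fix t assume "t < ?E \<gamma>0"
    then have "\<forall>\<^sub>F n in U. t \<le> ?E (\<gamma> n)"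
      using \<gamma>(1) \<gamma>0 assms by (intro fngw_energy_lower_semicontinuous[OF _ _ _ _ _ _ _ _ _ _ lsc[rule_format]]) (auto simp: couplings_def)
    then show "t \<le> FNGW \<alpha> \<beta> q p gX gY"
      by (rule tendsto_lowerbound[OF lim _ U(2)])
  qed
  moreover have "FNGW \<alpha> \<beta> q p gX gY \<le> ?E \<mu>" if "\<mu> \<in> ?C" for \<mu>
    unfolding FNGW_def using that by (rule INF_lower)
  ultimately show ?thesis
    using \<gamma>0 by (intro bexI[of _ \<gamma>0]) (auto intro: order_trans antisym)
qed

end
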